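(* For all sufficiently large integers $N$ there exists a set $A\subseteq\mathbb{Z}_N$ for which the Cayley sum graph $G_A$ has no clique and no independent set with at least $160\log N$ vertices.
   Context: $\mathbb{Z}_N=\mathbb{Z}/N\mathbb{Z}$. For a finite abelian group $\Gamma$ and $A\subseteq\Gamma$, the Cayley sum graph $G_A$ is the (simple) graph on vertex set $\Gamma$ in which distinct $i,j$ are joined by an edge precisely when $i+j\in A$. All logarithms are to base 2. *)

theory Defs
  imports Complex_Main "HOL-Library.Ramsey" "HOL-Algebra.Elementary_Groups"
begin

text \<open>
  Groups are written multiplicatively, as in HOL-Algebra: the sum $i + j$ is
  \<open>i \<otimes>\<^bsub>\<Gamma>\<^esub> j\<close>. The Cayley sum graph of \<open>A\<close> has vertex set \<^term>\<open>carrier \<Gamma>\<close>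
  and the edges below. The theory Ramsey supplies \<^const>\<open>clique\<close> and \<^const>\<open>indep\<close>;
  they relate a vertex set to an edge set and do not require the former to consist of
  vertices of a given graph, so that is to be stated separately.
\<close>

definition cayley_sum_edges :: "('a, 'b) monoid_scheme \<Rightarrow> 'a set \<Rightarrow> 'a set set" where
  "cayley_sum_edges \<Gamma> A =
    {{i, j} | i j. i \<in> carrier \<Gamma> \<and> j \<in> carrier \<Gamma> \<and> i \<noteq> j \<and> i \<otimes>\<^bsub>\<Gamma>\<^esub> j \<in> A}"

lemma cayley_sum_edges_subset: "cayley_sum_edges \<Gamma> A \<subseteq> nsets (carrier \<Gamma>) 2"
  by (auto simp: cayley_sum_edges_def)

lemma (in comm_group) doubleton_in_cayley_sum_edges:
  assumes "i \<in> carrier G" "j \<in> carrier G"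
  shows "{i, j} \<in> cayley_sum_edges G A \<longleftrightarrow> i \<noteq> j \<and> i \<otimes> j \<in> A"
  using assms by (auto simp: cayley_sum_edges_def doubleton_eq_iff m_comm)

end

theory Submission
  imports Defs "HOL-Real_Asymp.Real_Asymp"
begin

text \<open>
  A uniformly random \<open>A\<close> works. A clique with vertex set \<open>T\<close> forces the sums \<open>a + b\<close> of distinct
  \<open>a, b \<in> T\<close> into \<open>A\<close>, and an independent set forces them out of \<open>A\<close>; either event has probability
  \<open>2\<^sup>-\<^sup>m\<close>, where \<open>m\<close> is the number of these restricted sums. A union bound over all \<open>T\<close> of a given
  size \<open>k\<close> therefore succeeds once, for every \<open>m\<close>, at most \<open>2\<close> to the power \<open>0.95 m\<close> sets \<open>T\<close> have
  exactly \<open>m\<close> restricted sums. That is the content of the proof.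

  One of the two halves of the interval \<open>[0, N)\<close> contains half of any vertex set, and on sums of
  two elements of one half, reduction mod \<open>N\<close> is injective. Hence it suffices to count sets \<open>T\<close> of
  \<^emph>\<open>integers\<close> in \<open>[0, N)\<close> with \<open>k = 80 log N\<close> elements. The ordering of the integers is what
  excludes the subgroup-like sets that defeat the union bound in groups such as \<open>\<int>\<^sub>2\<^sup>n\<close>. A set of
  integers \<open>T\<close> with \<open>m\<close> restricted sums is encoded in three parts.

  \<^item> \<^emph>\<open>A generating set.\<close> By Freiman's lemma (\<open>small_generating_set\<close>), there is \<open>X \<subseteq> T\<close> with at most
    \<open>2m/k + 1\<close> elements from which \<open>T\<close> arises by completing parallelograms. Writing down \<open>X\<close> costs
    about \<open>(2m/k) log N = m/40\<close> bits.

  \<^item> \<^emph>\<open>A small modulus.\<close> Some \<open>q \<le> 2k\<^sup>5\<close> preserves all additive quadruples of \<open>T\<close>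
    (\<open>small_freiman_modulus\<close>), because an integer with too many small divisors is huge. The set
    \<open>T\<close> can be recovered from \<open>q\<close>, \<open>X\<close> and \<open>T mod q\<close> (\<open>determined_by_residues_and_generators\<close>).
    After this reduction an element costs only \<open>O(log k)\<close> bits instead of \<open>log N = k/80\<close>.

  \<^item> \<^emph>\<open>The residues.\<close> Let \<open>W\<close> consist of the roughly \<open>\<surd>k\<close> smallest elements of \<open>T\<close>. A greedy choice of
    \<open>O(m/\<surd>k)\<close> further elements \<open>F\<close> of \<open>T\<close> makes \<open>F + W\<close> contain most of every translate \<open>y + W\<close> with
    \<open>y \<in> T\<close> outside \<open>W\<close>. So these \<open>y\<close> lie in a container that depends on \<open>q\<close>, \<open>W\<close>, \<open>F\<close> only,
    whose size is at most \<open>8/7\<close> of the number of sums used; since \<open>W\<close> is the bottom of \<open>T\<close>, that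
    number is at most about \<open>m - k\<close> (\<open>residues_fingerprint\<close>). Choosing \<open>T mod q\<close> inside the
    container takes at most \<open>6(m + 1)/7\<close> bits, and \<open>W\<close> and \<open>F\<close> together cost \<open>o(m)\<close> bits.

  The total is \<open>m (6/7 + 1/40 + 1/80 + o(1)) < 0.95 m\<close>, the term \<open>1/80\<close> coming from the \<open>+ 1\<close> in the
  size of \<open>X\<close> and from \<open>k \<le> m + 1\<close>.
\<close>

section \<open>Restricted sums and generation by parallelograms\<close>

definition restricted_sums :: "'a::ab_group_add set \<Rightarrow> 'a set" where
  "restricted_sums T = {a + b | a b. a \<in> T \<and> b \<in> T \<and> a \<noteq> b}"

text \<open>
  The smallest superset of \<open>X\<close> to which every element of \<open>T\<close> that completes a parallelogram with
  three members belongs. When \<open>X \<subseteq> T\<close> and the closure contains \<open>T\<close>, a Freiman homomorphism on \<open>T\<close> is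
  determined by its values on \<open>X\<close>; the least size of such an \<open>X\<close> is a combinatorial substitute for the
  (affine) rank of \<open>T\<close>, and makes linear algebra unnecessary.
\<close>

inductive_set parallelogram_closure :: "'a::ab_group_add set \<Rightarrow> 'a set \<Rightarrow> 'a set"
  for T X where
  base: "x \<in> X \<Longrightarrow> x \<in> parallelogram_closure T X"
| step: "\<lbrakk>a \<in> parallelogram_closure T X; b \<in> parallelogram_closure T X;
          c \<in> parallelogram_closure T X; a + b - c \<in> T\<rbrakk>
         \<Longrightarrow> a + b - c \<in> parallelogram_closure T X"

lemma restricted_sumsI: "a \<in> T \<Longrightarrow> b \<in> T \<Longrightarrow> a \<noteq> b \<Longrightarrow> a + b \<in> restricted_sums T"
  by (auto simp: restricted_sums_def)

lemma restricted_sums_mono: "S \<subseteq> T \<Longrightarrow> restricted_sums S \<subseteq> restricted_sums T"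
  by (auto simp: restricted_sums_def)

lemma restricted_sums_subset_image:
  "restricted_sums T \<subseteq> (\<lambda>(a, b). a + b) ` (T \<times> T)"
  by (auto simp: restricted_sums_def)

lemma finite_restricted_sums [simp]: "finite T \<Longrightarrow> finite (restricted_sums T)"
  by (rule finite_subset[OF restricted_sums_subset_image]) auto

lemma card_restricted_sums_le:
  assumes "finite T"
  shows "card (restricted_sums T) \<le> (card T)\<^sup>2"
proof -
  have "card (restricted_sums T) \<le> card ((\<lambda>(a, b). a + b) ` (T \<times> T))"
    using assms by (intro card_mono restricted_sums_subset_image) auto
  also have "\<dots> \<le> card (T \<times> T)"
    using assms by (intro card_image_le) auto
  finally show ?thesis
    by (simp add: card_cartesian_product power2_eq_square)
qed

lemma card_le_Suc_card_restricted_sums: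
  assumes "finite T"
  shows "card T \<le> card (restricted_sums T) + 1"
proof (cases "T = {}")
  case False
  then obtain x where x: "x \<in> T" by blast
  have "card (T - {x}) = card ((+) x ` (T - {x}))"
    by (simp add: card_image)
  also have "\<dots> \<le> card (restricted_sums T)"
    using x assms by (intro card_mono) (auto intro: restricted_sumsI)
  finally show ?thesis
    using x assms by simp
qed auto

lemma parallelogram_closure_mono:
  assumes "S \<subseteq> T" "X \<subseteq> Y"
  shows "parallelogram_closure S X \<subseteq> parallelogram_closure T Y"
proof
  fix z assume "z \<in> parallelogram_closure S X"
  then show "z \<in> parallelogram_closure T Y"
    by induction (use assms in \<open>auto intro: parallelogram_closure.intros\<close>)
qed

text \<open>
  If \<open>x + a\<close> is not a new sum, then \<open>x + a = b + c\<close> with \<open>b, c < x\<close>, hence \<open>b, c > a\<close> and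
  \<open>a = b + c - x\<close>: such an \<open>a\<close> is generated by \<open>x\<close> and larger elements. By downward induction,
  everything is generated by \<open>x\<close> and the \<open>a\<close> for which \<open>x + a\<close> is new. In other words, adding a new
  maximum creates at least rank minus one many new restricted sums.
\<close>

lemma insert_subset_closure_of_new_sums:
  fixes T :: "'a::linordered_ab_group_add set"
  assumes "finite T" and max: "\<forall>a\<in>T. a < x"
  shows "insert x T \<subseteq>
    parallelogram_closure (insert x T) (insert x {a\<in>T. x + a \<notin> restricted_sums T})"
    (is "_ \<subseteq> ?C")
proof -
  have x: "x \<in> ?C"
    by (auto intro: parallelogram_closure.base)
  have "a \<in> ?C" if "a \<in> T" for a
    using that
  proof (induction "card {b\<in>T. a < b}" arbitrary: a rule: less_induct)
    case less
    show ?case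
    proof (cases "x + a \<in> restricted_sums T")
      case False
      then show ?thesis
        using less.prems by (auto intro: parallelogram_closure.base)
    next
      case True
      then obtain b c where bc: "b \<in> T" "c \<in> T" "x + a = b + c"
        by (auto simp: restricted_sums_def)
      have "a < b" "a < c"
        using max bc add_less_le_mono[of b x c a] add_less_le_mono[of c x b a]
        by (force simp: not_le[symmetric] add.commute)+
      have up: "d \<in> ?C" if "d \<in> T" "a < d" for d
      proof (rule less.hyps[OF _ that(1)])
        show "card {b\<in>T. d < b} < card {b\<in>T. a < b}"
          using that assms(1) by (intro psubset_card_mono) auto
      qed
      have a: "a = b + c - x"
        using bc(3) by (metis add_diff_cancel_left')
      show ?thesis
        unfolding a
        by (rule parallelogram_closure.step)
           (use up bc \<open>a < b\<close> \<open>a < c\<close> x less.prems a in auto)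
    qed
  qed
  with x show ?thesis by auto
qed

text \<open>
  Freiman's lemma for restricted sums, by adding the elements of \<open>T\<close> in increasing order. Let \<open>x\<close> be
  the new maximum, and \<open>X\<close> the generating set found for the old \<open>T\<close>. If \<open>x\<close> completes no parallelogram
  with elements of \<open>T\<close>, then the generating set grows by one, but all sums \<open>x + a\<close> are new. Otherwise
  \<open>X\<close> still generates, and so does \<open>x\<close> together with the \<open>a\<close> that give new sums; the smaller of the two
  sets has the required size.
\<close>

lemma small_generating_set:
  fixes T :: "'a::linordered_ab_group_add set"
  assumes "finite T" "T \<noteq> {}"
  shows "\<exists>X\<subseteq>T. X \<noteq> {} \<and> T \<subseteq> parallelogram_closure T X \<and>
    (card X - 1) * (2 * card T - card X) \<le> 2 * card (restricted_sums T)"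
  using assms
proof (induction T rule: finite_linorder_max_induct)
  case empty
  then show ?case by simp
next
  case (insert x T)
  show ?case
  proof (cases "T = {}")
    case True
    then show ?thesis
      by (intro exI[of _ "{x}"]) (auto intro: parallelogram_closure.base)
  next
    case False
    then obtain X where X: "X \<subseteq> T" "X \<noteq> {}" "T \<subseteq> parallelogram_closure T X"
      and bound: "(card X - 1) * (2 * card T - card X) \<le> 2 * card (restricted_sums T)"
      using insert.IH by blast
    define G where "G = {a\<in>T. x + a \<notin> restricted_sums T}"
    have fin: "finite X" "finite G" "G \<subseteq> T" and "x \<notin> T"
      using insert.hyps X by (auto simp: G_def finite_subset)
    have "card (restricted_sums T) + card G = card (restricted_sums T \<union> (+) x ` G)"
      using fin insert.hyps by (subst card_Un_disjoint) (auto simp: G_def card_image)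
    also have "\<dots> \<le> card (restricted_sums (insert x T))"
      using insert.hyps \<open>x \<notin> T\<close>
      by (intro card_mono Un_least)
         (auto simp: G_def intro: restricted_sumsI restricted_sums_mono[THEN subsetD])
    finally have growth: "card (restricted_sums T) + card G \<le> card (restricted_sums (insert x T))" .
    have cards: "card (insert x T) = card T + 1" "1 \<le> card X" "card X \<le> card T" "card G \<le> card T"
      using X fin insert.hyps \<open>x \<notin> T\<close> by (auto simp: card_mono Suc_le_eq card_gt_0_iff)
    have T_closure: "T \<subseteq> parallelogram_closure (insert x T) X"
      using X(3) parallelogram_closure_mono[of T "insert x T" X X] by blast
    \<comment> \<open>Both sides of the bound, in integers, so that the subtractions can be expanded.\<close>
    have arith: "?thesis" if Y: "Y \<subseteq> insert x T" "Y \<noteq> {}" "insert x T \<subseteq> parallelogram_closure (insert x T) Y"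
      and le: "(int (card Y) - 1) * (2 * int (card T) + 2 - int (card Y))
         \<le> (int (card X) - 1) * (2 * int (card T) - int (card X)) + 2 * int (card G)" for Y
    proof -
      have finY: "finite Y" and cY: "1 \<le> card Y" "card Y \<le> card T + 1"
        using Y insert.hyps cards(1) finite_subset[OF Y(1)] card_mono[OF _ Y(1)]
        by (auto simp: Suc_le_eq card_gt_0_iff)
      have "int ((card X - 1) * (2 * card T - card X))
          = (int (card X) - 1) * (2 * int (card T) - int (card X))"
        using cards by (simp add: of_nat_diff)
      moreover have "int ((card Y - 1) * (2 * card (insert x T) - card Y))
          = (int (card Y) - 1) * (2 * int (card T) + 2 - int (card Y))"
        using cards cY by (simp add: of_nat_diff)
      ultimately have "(card Y - 1) * (2 * card (insert x T) - card Y)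
          \<le> 2 * card (restricted_sums (insert x T))"
        using le bound growth by linarith
      with Y show ?thesis by blast
    qed
    show ?thesis
    proof (cases "G = T")
      case True
      have "insert x T \<subseteq> parallelogram_closure (insert x T) (insert x X)"
        using T_closure parallelogram_closure_mono[of "insert x T" "insert x T" X "insert x X"]
        by (auto intro: parallelogram_closure.base)
      moreover have "x \<notin> X" using X(1) \<open>x \<notin> T\<close> by blast
      then have "card (insert x X) = card X + 1"
        using fin by simp
      ultimately show ?thesis
        using X True by (intro arith[of "insert x X"]) (auto simp: algebra_simps)
    next
      case False
      then obtain a b c where abc: "a \<in> T" "b \<in> T" "c \<in> T" "x + a = b + c"
        using fin(3) by (auto simp: G_def restricted_sums_def)
      then have "x = b + c - a" by (metis add_diff_cancel_right')
      have "x \<in> parallelogram_closure (insert x T) X"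
        unfolding \<open>x = b + c - a\<close>
        by (rule parallelogram_closure.step)
          (use T_closure abc \<open>x = b + c - a\<close> in auto)
      then have X_gen: "insert x T \<subseteq> parallelogram_closure (insert x T) X"
        using T_closure by auto
      show ?thesis
      proof (cases "card X \<le> card G + 1")
        case True
        then show ?thesis
          using X X_gen by (intro arith[of X]) (auto simp: algebra_simps)
      next
        case False
        have "x \<notin> G" using fin(3) \<open>x \<notin> T\<close> by blast
        then have "card (insert x G) = card G + 1"
          using fin by simp
        \<comment> \<open>The bound for \<open>X\<close> implies that for a smaller set, as \<open>(x - 1) * (2 * n - x)\<close> increases up to \<open>x = n\<close>.\<close>
        moreover have "0 \<le> (int (card X) - (int (card G) + 1)) * (2 * int (card T) - int (card X) - int (card G))"
          using False cards by (intro mult_nonneg_nonneg) auto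
        ultimately show ?thesis
          using fin insert_subset_closure_of_new_sums[OF insert.hyps(1,2)]
          by (intro arith[of "insert x G"]) (auto simp: algebra_simps G_def)
      qed
    qed
  qed
qed

section \<open>A small modulus that is a Freiman isomorphism\<close>

text \<open>
  The numbers \<open>1 / (c * (r choose c))\<close> form Leibniz's harmonic triangle: each is a difference of two
  entries in the previous column, and the first column is \<open>1 / r\<close>. So \<open>Lcm {1..n}\<close> clears all
  denominators up to row \<open>n\<close>. This makes \<open>Lcm {1..n}\<close> exponentially large without any information on
  primes.
\<close>

lemma leibniz_triangle_clears:
  assumes "1 \<le> c" "c \<le> r" "r \<le> n"
  shows "real (Lcm {1..n}) / (real c * real (r choose c)) \<in> \<int>"
  using assms
proof (induction c arbitrary: r rule: nat_induct_at_least)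
  case base
  then have "r dvd Lcm {1..n}" by (intro dvd_Lcm) auto
  then obtain z where "Lcm {1..n} = r * z" ..
  then show ?case using base by simp
next
  case (Suc c)
  define L where "L = real (Lcm {1..n})"
  from Suc.prems Suc.hyps obtain s where s: "r = Suc s" "c \<le> s" by (cases r) auto
  have pos: "real (s choose c) > 0" "real (r choose c) > 0" "real (r choose Suc c) > 0"
    using s by (simp_all only: of_nat_0_less_iff zero_less_binomial_iff)
  have e1: "real (Suc c) * real (r choose Suc c) = real (Suc s) * real (s choose c)"
    using s Suc_times_binomial[of c s] by (metis of_nat_mult)
  define d where "d = real (r - c)"
  have d: "d > 0" "real (Suc s) = real c + d"
    using s by (auto simp: d_def of_nat_diff)
  have "(r - c) * (r choose c) = Suc s * (s choose c)"
    using binomial_absorb_comp[of r c] s by simp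
  then have "d * real (r choose c) = (real c + d) * real (s choose c)"
    unfolding d(2)[symmetric] unfolding d_def by (simp only: of_nat_mult[symmetric])
  then have e2: "real (r choose c) = (real c + d) * real (s choose c) / d"
    using d(1) by (simp add: field_simps)
  have "L / ((real c + d) * B) = L / (real c * B) - L / (real c * ((real c + d) * B / d))"
    if "B > 0" for B
  proof -
    have "real c > 0" using Suc.hyps by simp
    then show ?thesis using that d(1) by (simp add: divide_simps) (simp add: algebra_simps)
  qed
  then have "L / (real (Suc c) * real (r choose Suc c))
      = L / (real c * real (s choose c)) - L / (real c * real (r choose c))"
    unfolding e1 e2 d(2) using pos(1) by blast
  moreover have "L / (real c * real (s choose c)) \<in> \<int>" "L / (real c * real (r choose c)) \<in> \<int>"
    using Suc s by (auto simp: L_def)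
  ultimately show ?case unfolding L_def by simp
qed

lemma Lcm_lower_bound:
  assumes "n > 0"
  shows "4 ^ n \<le> 2 * Lcm {1..2 * n}"
proof -
  define L where "L = Lcm {1..2 * n}"
  have "L \<noteq> 0" by (auto simp: L_def Lcm_0_iff)
  have "real L / (real n * real (2 * n choose n)) \<in> \<int>"
    unfolding L_def using assms by (intro leibniz_triangle_clears) auto
  then obtain z where z: "real L / (real n * real (2 * n choose n)) = of_int z"
    by (auto elim: Ints_cases)
  have pos: "real n * real (2 * n choose n) > 0"
    using assms by (simp add: zero_less_binomial)
  have "real_of_int z > 0"
    using z pos \<open>L \<noteq> 0\<close> by (metis divide_pos_pos gr0I of_nat_0_less_iff)
  then have "real_of_int z \<ge> 1" by simp
  then have "real n * real (2 * n choose n) \<le> real L"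
    using z pos by (simp only: le_divide_eq_1_pos[OF pos, symmetric])
  moreover have "4 ^ n \<le> 2 * (real n * real (2 * n choose n))"
    using central_binomial_lower_bound[OF assms] assms by (simp add: field_simps)
  ultimately have "real (4 ^ n) \<le> real (2 * L)" by simp
  then show ?thesis unfolding L_def by (simp only: of_nat_le_iff)
qed

text \<open>
  If all numbers up to \<open>2 * n\<close> divided \<open>P\<close>, so would their least common multiple, which exceeds \<open>\<bar>P\<bar>\<close>.
\<close>

lemma small_nondivisor:
  fixes P :: int
  assumes "P \<noteq> 0" "n > 0" "2 * \<bar>P\<bar> < 4 ^ n"
  shows "\<exists>q\<in>{1..2 * n}. \<not> int q dvd P"
proof (rule ccontr)
  assume "\<not> ?thesis"
  then have "\<forall>q\<in>{1..2 * n}. q dvd nat \<bar>P\<bar>"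
    by auto
  then have "Lcm {1..2 * n} dvd nat \<bar>P\<bar>"
    by (intro Lcm_least) auto
  then have "Lcm {1..2 * n} \<le> nat \<bar>P\<bar>"
    using assms(1) by (intro dvd_imp_le) auto
  with Lcm_lower_bound[OF assms(2)] have "4 ^ n \<le> 2 * nat \<bar>P\<bar>" by linarith
  then have "int (4 ^ n) \<le> int (2 * nat \<bar>P\<bar>)" by (simp only: of_nat_le_iff)
  with assms(3) show False by simp
qed

text \<open>
  Reduction mod \<open>q\<close> restricted to \<open>T\<close> is a Freiman isomorphism (of order 2) onto its image.
\<close>

definition freiman_modulus :: "int \<Rightarrow> int set \<Rightarrow> bool" where
  "freiman_modulus q T \<longleftrightarrow>
    (\<forall>a\<in>T. \<forall>b\<in>T. \<forall>c\<in>T. \<forall>d\<in>T. q dvd a + b - c - d \<longrightarrow> a + b = c + d)"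

text \<open>
  A suitable \<open>q\<close> is one that does not divide the product of all nonzero \<open>a + b - c - d\<close> with
  \<open>a, b, c, d \<in> T\<close>: these are at most \<open>k\<^sup>4\<close> factors, each at most \<open>2\<^sup>k\<close> in absolute value.
\<close>

lemma small_freiman_modulus:
  fixes T :: "int set"
  assumes T: "T \<subseteq> {0..<int N}" "card T = k" and k: "2 \<le> k" "2 * N \<le> 2 ^ k"
  shows "\<exists>q\<in>{1..2 * k ^ 5}. freiman_modulus (int q) T"
proof -
  define f where "f = (\<lambda>(a, b, c, d). a + b - c - d :: int)"
  define Q where "Q = {p \<in> T \<times> T \<times> T \<times> T. f p \<noteq> 0}"
  have finT: "finite T" using T k by (auto intro: finite_subset)
  then have finQ: "finite Q" by (auto simp: Q_def)
  have "card Q \<le> card (T \<times> T \<times> T \<times> T)"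
    using finT by (intro card_mono) (auto simp: Q_def)
  also have "\<dots> = k ^ 4" using T by (simp add: card_cartesian_product eval_nat_numeral)
  finally have cardQ: "card Q \<le> k ^ 4" .
  have le: "\<bar>f p\<bar> \<le> 2 ^ k" if "p \<in> Q" for p
  proof -
    obtain a b c d where p: "p = (a, b, c, d)" by (cases p)
    with that T(1) have "a \<in> {0..<int N}" "b \<in> {0..<int N}" "c \<in> {0..<int N}" "d \<in> {0..<int N}"
      by (auto simp: Q_def)
    then have "\<bar>f p\<bar> \<le> int (2 * N)"
      by (auto simp: f_def p)
    also have "\<dots> \<le> int (2 ^ k)" using k by (simp only: of_nat_le_iff)
    finally show ?thesis by simp
  qed
  have "\<bar>prod f Q\<bar> = (\<Prod>p\<in>Q. \<bar>f p\<bar>)"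
    using finQ by induction (auto simp: abs_mult)
  also have "\<dots> \<le> (\<Prod>p\<in>Q. 2 ^ k)"
    by (intro prod_mono) (auto intro: le)
  also have "\<dots> = 2 ^ (k * card Q)" by (simp add: power_mult)
  also have "\<dots> \<le> 2 ^ (k * k ^ 4)" using cardQ by (intro power_increasing mult_left_mono) auto
  also have "k * k ^ 4 = k ^ 5" by (simp add: eval_nat_numeral)
  finally have "2 * \<bar>prod f Q\<bar> \<le> 2 ^ Suc (k ^ 5)" by simp
  also have "Suc (k ^ 5) < 2 * k ^ 5"
    using one_less_power[of k 5] k by linarith
  then have "(2::int) ^ Suc (k ^ 5) < 2 ^ (2 * k ^ 5)" by (intro power_strict_increasing) auto
  also have "\<dots> = 4 ^ (k ^ 5)" by (simp add: power_mult)
  finally have "2 * \<bar>prod f Q\<bar> < 4 ^ (k ^ 5)" .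
  moreover have "prod f Q \<noteq> 0" using finQ by (auto simp: Q_def)
  ultimately obtain q where q: "q \<in> {1..2 * k ^ 5}" "\<not> int q dvd prod f Q"
    using small_nondivisor[of "prod f Q" "k ^ 5"] k by auto
  have "a + b = c + d" if "a \<in> T" "b \<in> T" "c \<in> T" "d \<in> T" "int q dvd a + b - c - d" for a b c d
  proof (rule ccontr)
    assume "a + b \<noteq> c + d"
    then have "(a, b, c, d) \<in> Q" using that by (auto simp: Q_def f_def)
    then have "f (a, b, c, d) dvd prod f Q" using finQ by (intro dvd_prodI)
    with q that(5) show False by (auto simp: f_def intro: dvd_trans)
  qed
  with q(1) show ?thesis unfolding freiman_modulus_def by blast
qed

lemma freiman_modulus_inj_on:
  assumes "freiman_modulus q T"
  shows "inj_on (\<lambda>t. t mod q) T"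
proof (rule inj_onI)
  fix a b assume *: "a \<in> T" "b \<in> T" "a mod q = b mod q"
  \<comment> \<open>A degenerate parallelogram turns the congruence into an equation between sums.\<close>
  then have "q dvd a + a - b - a" by (simp add: mod_eq_dvd_iff)
  with assms * have "a + a = b + a" unfolding freiman_modulus_def by blast
  then show "a = b" by simp
qed

text \<open>
  Two sets with the same residues correspond under a bijection that preserves residues. It fixes \<open>X\<close>,
  and it respects parallelograms because \<open>q\<close> is a Freiman modulus of \<open>S\<close>; so it fixes all that \<open>X\<close>
  generates.
\<close>

lemma determined_by_residues_and_generators:
  assumes S: "freiman_modulus q S" and T: "finite T"
    and res: "(\<lambda>t. t mod q) ` S = (\<lambda>t. t mod q) ` T" "card S = card T"
    and X: "X \<subseteq> S" "X \<subseteq> T" "T \<subseteq> parallelogram_closure T X"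
  shows "S = T"
proof -
  have "t \<in> S" if "t \<in> parallelogram_closure T X" for t
    using that
  proof induction
    case (base x)
    then show ?case using X by auto
  next
    case (step a b c)
    then obtain d where d: "d \<in> S" "(a + b - c) mod q = d mod q"
      using res(1) by (metis (no_types, lifting) imageE imageI)
    then have "q dvd a + b - c - d" by (simp add: mod_eq_dvd_iff)
    with S step d have "a + b = c + d" unfolding freiman_modulus_def by blast
    then show ?case using d by (simp add: algebra_simps)
  qed
  with X have "T \<subseteq> S" by blast
  moreover have "finite S"
    using res T freiman_modulus_inj_on[OF S] by (metis finite_imageI finite_image_iff)
  ultimately show ?thesis using res(2) by (metis card_subset_eq)
qed

section \<open>A container for the residues\<close>

text \<open>
  As long as some \<open>\<N> y\<close> has more than \<open>w / c\<close> elements outside the part of the union covered so far,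
  adding \<open>y\<close> to \<open>F\<close> enlarges the covered part by more than \<open>w / c\<close>. A maximal \<open>F\<close> with
  \<open>w * card F \<le> c * card (\<Union>f\<in>F. \<N> f)\<close> is where this process stops.
\<close>

lemma greedy_fingerprint:
  fixes \<N> :: "'a \<Rightarrow> 'b set"
  assumes "finite A" "\<And>y. y \<in> A \<Longrightarrow> finite (\<N> y)" "0 < w"
  shows "\<exists>F\<subseteq>A. w * card F \<le> c * card (\<Union>y\<in>A. \<N> y) \<and>
    (\<forall>y\<in>A. c * card (\<N> y - (\<Union>f\<in>F. \<N> f)) \<le> w)"
proof -
  define P where "P F \<longleftrightarrow> F \<subseteq> A \<and> w * card F \<le> c * card (\<Union>f\<in>F. \<N> f)" for F
  have "P {}" by (simp add: P_def)
  moreover have "\<forall>F. P F \<longrightarrow> card F < Suc (card A)"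
    using assms(1) by (auto simp: P_def card_mono less_Suc_eq_le)
  ultimately have "\<exists>F. P F \<and> (\<forall>F'. P F' \<longrightarrow> card F' \<le> card F)"
    by (rule ex_has_greatest_nat)
  then obtain F where F: "P F" and max: "\<And>F'. P F' \<Longrightarrow> card F' \<le> card F"
    by blast
  from F have FA: "F \<subseteq> A" "finite F" using assms(1) by (auto simp: P_def finite_subset)
  have fin: "finite (\<Union>f\<in>F. \<N> f)" using FA assms by auto
  have "c * card (\<N> y - (\<Union>f\<in>F. \<N> f)) \<le> w" if "y \<in> A" for y
  proof (rule ccontr)
    assume *: "\<not> ?thesis"
    have "y \<notin> F"
    proof
      assume "y \<in> F"
      then have "\<N> y - (\<Union>f\<in>F. \<N> f) = {}" by blast
      with * show False by (simp only: card.empty mult_0_right le0 not_True_eq_False)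
    qed
    have "(\<Union>f\<in>insert y F. \<N> f) = (\<Union>f\<in>F. \<N> f) \<union> (\<N> y - (\<Union>f\<in>F. \<N> f))" by auto
    then have "card (\<Union>f\<in>insert y F. \<N> f) = card (\<Union>f\<in>F. \<N> f) + card (\<N> y - (\<Union>f\<in>F. \<N> f))"
      using fin assms(2)[OF that] by (metis Diff_disjoint card_Un_disjoint finite_Diff)
    then have "P (insert y F)"
      using F * that FA \<open>y \<notin> F\<close> by (simp add: P_def algebra_simps)
    from max[OF this] show False using FA \<open>y \<notin> F\<close> by simp
  qed
  moreover have "c * card (\<Union>f\<in>F. \<N> f) \<le> c * card (\<Union>y\<in>A. \<N> y)"
    using FA assms by (intro mult_left_mono card_mono) auto
  ultimately show ?thesis
    using F FA by (auto simp: P_def intro!: exI[of _ F] elim: order_trans)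
qed

text \<open>
  Double counting of the incidences \<open>u \<in> \<N> y\<close> with \<open>u \<in> Z\<close>: each \<open>y\<close> in the container contributes at
  least \<open>(1 - 1/c) * w\<close>, each \<open>u\<close> at most \<open>w\<close>.
\<close>

lemma card_container_le:
  fixes \<N> :: "'a \<Rightarrow> 'b set"
  assumes "finite Q" "finite Z" "0 < w"
    and size: "\<And>y. y \<in> Q \<Longrightarrow> finite (\<N> y) \<and> card (\<N> y) = w"
    and deg: "\<And>u. card {y\<in>Q. u \<in> \<N> y} \<le> w"
  shows "(c - 1) * card {y\<in>Q. c * card (\<N> y - Z) \<le> w} \<le> c * card Z"
proof -
  define Y where "Y = {y\<in>Q. c * card (\<N> y - Z) \<le> w}"
  have finY: "finite Y" using assms by (auto simp: Y_def)
  have row: "(c - 1) * w \<le> c * card (\<N> y \<inter> Z)" if "y \<in> Y" for y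
  proof -
    have "card (\<N> y \<inter> Z) + card (\<N> y - Z) = w"
      using size[of y] that card_Int_Diff[of "\<N> y" Z] by (auto simp: Y_def)
    then have "c * w = c * card (\<N> y \<inter> Z) + c * card (\<N> y - Z)"
      by (metis distrib_left)
    moreover have "c * card (\<N> y - Z) \<le> w" using that by (simp add: Y_def)
    moreover have "(c - 1) * w = c * w - w" by (simp add: diff_mult_distrib)
    ultimately show ?thesis by linarith
  qed
  have "w * ((c - 1) * card Y) = (\<Sum>y\<in>Y. (c - 1) * w)" by simp
  also have "\<dots> \<le> (\<Sum>y\<in>Y. c * card (\<N> y \<inter> Z))" using row by (rule sum_mono)
  also have "\<dots> = c * (\<Sum>y\<in>Y. card {u\<in>Z. u \<in> \<N> y})"
    by (simp add: sum_distrib_left Int_def conj_commute)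
  also have "(\<Sum>y\<in>Y. card {u\<in>Z. u \<in> \<N> y}) = (\<Sum>u\<in>Z. card {y\<in>Y. u \<in> \<N> y})"
    using sum_multicount_gen[OF finY assms(2), of "\<lambda>y u. u \<in> \<N> y"] by simp
  also have "\<dots> \<le> (\<Sum>u\<in>Z. w)"
  proof (rule sum_mono)
    fix u
    have "card {y\<in>Y. u \<in> \<N> y} \<le> card {y\<in>Q. u \<in> \<N> y}"
      using assms(1) by (intro card_mono) (auto simp: Y_def)
    with deg show "card {y\<in>Y. u \<in> \<N> y} \<le> w" by (rule order_trans[rotated])
  qed
  also have "c * (\<Sum>u\<in>Z. w) = w * (c * card Z)" by simp
  finally show ?thesis using assms(3) by (simp add: Y_def)
qed

lemma obtain_lowest_elements:
  fixes T :: "'a::linorder set"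
  assumes "finite T" "w \<le> card T"
  shows "\<exists>W\<subseteq>T. card W = w \<and> (\<forall>a\<in>W. \<forall>b\<in>T - W. a < b)"
  using assms(2)
proof (induction w)
  case 0
  then show ?case by (intro exI[of _ "{}"]) auto
next
  case (Suc w)
  then obtain W where W: "W \<subseteq> T" "card W = w" "\<forall>a\<in>W. \<forall>b\<in>T - W. a < b" by auto
  have fin: "finite W" "finite (T - W)" using W assms(1) finite_subset by auto
  have "T - W \<noteq> {}" using W Suc.prems by auto
  then have Min: "Min (T - W) \<in> T - W" using fin by (intro Min_in)
  have "Min (T - W) < b" if "b \<in> T - insert (Min (T - W)) W" for b
    using that fin Min_le[of "T - W" b] by (auto simp: less_le)
  with W Min fin show ?case
    by (intro exI[of _ "insert (Min (T - W)) W"]) auto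
qed

text \<open>
  Adding the maximum \<open>x\<close> of \<open>T\<close> to the elements of \<open>T - W\<close> below \<open>x\<close> gives \<open>card (T - W) - 1\<close> sums, and
  these exceed every sum of an element of \<open>T\<close> and an element of the lower part \<open>W\<close>. The gain of
  \<open>card (T - W)\<close> is essential for the count: without it a set of small doubling would be sought in a
  container of about \<open>m\<close> elements, which may have nearly \<open>2\<^sup>m\<close> subsets of the right size.
\<close>

lemma card_sums_with_lowest_le:
  fixes T :: "'a::linordered_ab_group_add set"
  assumes "finite T" "W \<subset> T" and low: "\<forall>a\<in>W. \<forall>b\<in>T - W. a < b"
  shows "card ((\<lambda>(a, b). a + b) ` ((T - W) \<times> W)) + card (T - W) \<le> card (restricted_sums T) + 1"
proof -
  define x where "x = Max (T - W)"
  have fin: "finite (T - W)" "T - W \<noteq> {}" using assms by auto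
  then have x: "x \<in> T - W" unfolding x_def by (rule Max_in)
  have max: "a \<le> x" if "a \<in> T - W" for a
    unfolding x_def using fin(1) that by (rule Max_ge)
  define A where "A = (\<lambda>(a, b). a + b) ` ((T - W) \<times> W)"
  define B where "B = (+) x ` (T - W - {x})"
  have "A \<inter> B = {}"
  proof -
    have "a + b < x + c" if "a \<in> T - W" "b \<in> W" "c \<in> T - W" for a b c
      using that low max[of a] by (intro add_le_less_mono) auto
    then show ?thesis by (force simp: A_def B_def)
  qed
  moreover have "finite A" "finite B"
    using assms fin finite_subset[of W T] by (auto simp: A_def B_def)
  moreover have "card B = card (T - W) - 1"
    using x fin by (simp add: B_def card_image)
  ultimately have "card A + (card (T - W) - 1) = card (A \<union> B)"
    by (simp add: card_Un_disjoint)
  also have "\<dots> \<le> card (restricted_sums T)"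
    using assms x by (intro card_mono) (auto simp: A_def B_def intro!: restricted_sumsI)
  finally show ?thesis using fin x by (simp add: A_def)
qed

definition translate_mod :: "nat \<Rightarrow> int set \<Rightarrow> int \<Rightarrow> int set" where
  "translate_mod q W y = (\<lambda>v. (y + v) mod int q) ` W"

text \<open>
  The residues \<open>y\<close> for which at most one eighth of \<open>y + W\<close> is outside \<open>F + W\<close>. It is a function of \<open>q\<close>,
  \<open>W\<close> and \<open>F\<close>, so that recording these three records the container.
\<close>

definition sum_container :: "nat \<Rightarrow> int set \<Rightarrow> int set \<Rightarrow> int set" where
  "sum_container q W F =
    {y\<in>{0..<int q}. 8 * card (translate_mod q W y - (\<Union>f\<in>F. translate_mod q W f)) \<le> card W}"

lemma eq_if_mod_eq:
  fixes x y q :: int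
  assumes "x \<in> {0..<q}" "y \<in> {0..<q}" "q dvd x - y"
  shows "x = y"
  using assms by (metis atLeastLessThan_iff mod_eq_dvd_iff mod_pos_pos_trivial)

lemma card_sum_container_le:
  assumes W: "W \<subseteq> {0..<int q}" "W \<noteq> {}" and "finite F"
  shows "7 * card (sum_container q W F) \<le> 8 * card (\<Union>f\<in>F. translate_mod q W f)"
proof -
  have finW: "finite W" using W finite_subset by blast
  have size: "finite (translate_mod q W y) \<and> card (translate_mod q W y) = card W" for y
  proof -
    have "inj_on (\<lambda>v. (y + v) mod int q) W"
    proof (rule inj_onI)
      fix u v assume "u \<in> W" "v \<in> W" "(y + u) mod int q = (y + v) mod int q"
      then show "u = v"
        using W(1) by (intro eq_if_mod_eq[of u "int q" v]) (auto simp: mod_eq_dvd_iff)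
    qed
    with finW show ?thesis by (simp add: translate_mod_def card_image)
  qed
  have deg: "card {y\<in>{0..<int q}. u \<in> translate_mod q W y} \<le> card W" for u
  proof -
    have "{y\<in>{0..<int q}. u \<in> translate_mod q W y} \<subseteq> (\<lambda>v. (u - v) mod int q) ` W"
    proof clarify
      fix y assume y: "y \<in> {0..<int q}" "u \<in> translate_mod q W y"
      then obtain v where "v \<in> W" "u = (y + v) mod int q" by (auto simp: translate_mod_def)
      moreover from this y have "y = (u - v) mod int q" by (simp add: mod_diff_left_eq)
      ultimately show "y \<in> (\<lambda>v. (u - v) mod int q) ` W" by blast
    qed
    then have "card {y\<in>{0..<int q}. u \<in> translate_mod q W y} \<le> card ((\<lambda>v. (u - v) mod int q) ` W)"
      using finW by (intro card_mono) auto
    also have "\<dots> \<le> card W" using finW by (rule card_image_le)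
    finally show ?thesis .
  qed
  have "(8 - 1) * card (sum_container q W F) \<le> 8 * card (\<Union>f\<in>F. translate_mod q W f)"
    unfolding sum_container_def using finW W(2) assms(3) size deg
    by (intro card_container_le) (auto simp: card_gt_0_iff)
  then show ?thesis by simp
qed

text \<open>
  With \<open>W\<close> the residues of the \<open>w\<close> lowest elements of \<open>T\<close> and \<open>R\<close> those of the others, the greedy
  fingerprint is applied to the translates \<open>y + W\<close> with \<open>y \<in> R\<close>. Their union has at most as many
  elements as the corresponding set of integer sums, to which \<open>card_sums_with_lowest_le\<close> applies.
\<close>

lemma residues_fingerprint:
  fixes T :: "int set"
  assumes T: "finite T" "freiman_modulus (int q) T" "0 < q" and w: "0 < w" "w < card T"
  defines "m \<equiv> card (restricted_sums T)"
  shows "\<exists>W F R. W \<subseteq> {0..<int q} \<and> card W = w \<and> F \<subseteq> {0..<int q} \<and> w * card F \<le> 8 * m \<and>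
    R \<subseteq> sum_container q W F \<and> card R = card T - w \<and>
    7 * card (sum_container q W F) + 8 * card R \<le> 8 * (m + 1) \<and>
    (\<lambda>t. t mod int q) ` T = W \<union> R"
proof -
  let ?h = "\<lambda>t. t mod int q"
  obtain V where V: "V \<subseteq> T" "card V = w" "\<forall>a\<in>V. \<forall>b\<in>T - V. a < b"
    using obtain_lowest_elements[of T w] T w by auto
  then have "V \<subset> T" using w by auto
  define W R where "W = ?h ` V" and "R = ?h ` (T - V)"
  have inj: "inj_on ?h T" using T(2) by (rule freiman_modulus_inj_on)
  have "finite V" using V(1) T(1) by (rule finite_subset)
  then have fin: "finite V" "finite W" "finite R" using T(1) by (auto simp: W_def R_def)
  have sub: "W \<subseteq> {0..<int q}" "R \<subseteq> {0..<int q}" using T(3) by (auto simp: W_def R_def)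
  have cW: "card W = w" using V inj by (auto simp: W_def card_image inj_on_subset)
  have cR: "card R = card (T - V)" using inj by (auto simp: R_def card_image inj_on_subset)
  have "(\<Union>y\<in>R. translate_mod q W y) \<subseteq> ?h ` (\<lambda>(a, b). a + b) ` ((T - V) \<times> V)"
    by (force simp: translate_mod_def W_def R_def mod_add_eq)
  then have "card (\<Union>y\<in>R. translate_mod q W y) \<le> card (?h ` (\<lambda>(a, b). a + b) ` ((T - V) \<times> V))"
    using T fin by (intro card_mono) auto
  also have "\<dots> \<le> card ((\<lambda>(a, b). a + b) ` ((T - V) \<times> V))"
    using T fin by (intro card_image_le) auto
  finally have U: "card (\<Union>y\<in>R. translate_mod q W y) + card R \<le> m + 1"
    using card_sums_with_lowest_le[OF T(1) \<open>V \<subset> T\<close> V(3)] cR by (simp add: m_def)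
  have finN: "finite (translate_mod q W y)" for y using fin by (simp add: translate_mod_def)
  then obtain F where F: "F \<subseteq> R" "w * card F \<le> 8 * card (\<Union>y\<in>R. translate_mod q W y)"
      "\<forall>y\<in>R. 8 * card (translate_mod q W y - (\<Union>f\<in>F. translate_mod q W f)) \<le> w"
    using greedy_fingerprint[of R "translate_mod q W" w 8] fin w by auto
  have finF: "finite F" using F fin finite_subset by blast
  have "card R > 0" using cR \<open>V \<subset> T\<close> T by (auto simp: card_gt_0_iff)
  then have "w * card F \<le> 8 * m" using F(2) U by linarith
  moreover have "R \<subseteq> sum_container q W F"
    using F(3) sub cW by (auto simp: sum_container_def)
  moreover have "7 * card (sum_container q W F) + 8 * card R \<le> 8 * (m + 1)"
  proof -
    have scaled: "7 * y + 8 * r \<le> 8 * (m + 1)" if "7 * y \<le> 8 * u" "u \<le> v" "v + r \<le> m + 1"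
      for y r u v :: nat
      using that by presburger
    have "W \<noteq> {}" using cW w by auto
    then have "7 * card (sum_container q W F) \<le> 8 * card (\<Union>f\<in>F. translate_mod q W f)"
      using sub finF by (intro card_sum_container_le)
    moreover have "card (\<Union>f\<in>F. translate_mod q W f) \<le> card (\<Union>y\<in>R. translate_mod q W y)"
      using F fin finN by (intro card_mono) auto
    ultimately show ?thesis using U
      by (rule scaled)
  qed
  moreover have "card R = card T - w"
    using cR V fin by (simp add: card_Diff_subset)
  moreover have "?h ` T = W \<union> R" using V by (auto simp: W_def R_def)
  moreover have "F \<subseteq> {0..<int q}" using F sub by blast
  ultimately show ?thesis using sub cW by blast
qed

section \<open>Counting sets by their number of restricted sums\<close>

lemma card_small_subsets_le:
  assumes "finite A"
  shows "finite {F. F \<subseteq> A \<and> card F \<le> f} \<and> card {F. F \<subseteq> A \<and> card F \<le> f} \<le> (card A + 1) ^ f"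
proof (induction f)
  case 0
  have "{F. F \<subseteq> A \<and> card F \<le> 0} = {{}}"
    using finite_subset[OF _ assms] by auto
  then show ?case by simp
next
  case (Suc f)
  define S where "S = {F. F \<subseteq> A \<and> card F \<le> f}"
  define E where "E = insert {} ((\<lambda>a. {a}) ` A)"
  have E: "finite E" "card E \<le> card A + 1"
    using assms card_insert_le_m1[of "card A + 1" "(\<lambda>a. {a}) ` A" "{}"] card_image_le[of A "\<lambda>a. {a}"]
    by (auto simp: E_def)
  have "{F. F \<subseteq> A \<and> card F \<le> Suc f} \<subseteq> (\<lambda>(F, e). F \<union> e) ` (S \<times> E)"
  proof clarify
    fix F assume F: "F \<subseteq> A" "card F \<le> Suc f"
    show "F \<in> (\<lambda>(F, e). F \<union> e) ` (S \<times> E)"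
    proof (cases "F = {}")
      case True
      then show ?thesis by (intro image_eqI[of _ _ "({}, {})"]) (auto simp: S_def E_def)
    next
      case False
      then obtain a where a: "a \<in> F" by blast
      have "finite F" using F assms finite_subset by blast
      with a F show ?thesis
        by (intro image_eqI[of _ _ "(F - {a}, {a})"]) (auto simp: S_def E_def)
    qed
  qed
  moreover have "finite (S \<times> E)" using E Suc by (simp add: S_def)
  moreover have "card (S \<times> E) \<le> (card A + 1) ^ f * (card A + 1)"
    unfolding card_cartesian_product using E Suc by (intro mult_mono) (auto simp: S_def)
  ultimately show ?case
    by (metis (no_types, lifting) surj_card_le finite_surj le_trans power_Suc2)
qed

lemma binomial_le_powers:
  fixes x :: real
  assumes "x > 0"
  shows "real (n choose r) \<le> (1 + x) ^ n * (1 / x) ^ r"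
proof (cases "r \<le> n")
  case True
  have "real (n choose r) * x ^ r * 1 ^ (n - r) \<le> (\<Sum>i\<le>n. real (n choose i) * x ^ i * 1 ^ (n - i))"
    using True assms by (intro member_le_sum) auto
  also have "\<dots> = (x + 1) ^ n" by (rule binomial_ring[symmetric])
  finally show ?thesis using assms by (simp add: field_simps)
next
  case False
  then have "n choose r = 0" by (intro binomial_eq_0) simp
  then show ?thesis using assms by (simp only: of_nat_0) simp
qed

text \<open>
  With \<open>binomial_le_powers\<close> for \<open>x = 2/3\<close>, this bounds the number of \<open>s\<close>-subsets of a container of size
  \<open>y\<close>. The choice of \<open>x\<close> makes one estimate serve for all ratios of \<open>m\<close> to \<open>s\<close>: both \<open>5/3\<close> and \<open>3/2\<close> are
  at most \<open>2\<^sup>3\<^sup>/\<^sup>4\<close>, and \<open>3/4 * 8/7 = 6/7\<close>.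
\<close>

lemma five_thirds_powers_le:
  assumes "7 * y + 8 * s \<le> 8 * (m + 1)"
  shows "(5 / 3 :: real) ^ y * (3 / 2) ^ s \<le> 2 powr (6 * (real m + 1) / 7)"
proof -
  have "(2 powr (3 / 4)) ^ 4 = (2::real) powr 3" by (simp add: powr_powr flip: powr_realpow)
  then have p: "(2 powr (3 / 4)) ^ 4 = (8::real)" by (simp add: eval_nat_numeral)
  have "5 / 3 \<le> (2::real) powr (3 / 4)" "3 / 2 \<le> (2::real) powr (3 / 4)"
    using p power_mono_iff[of "5 / 3" "2 powr (3 / 4) :: real" 4]
      power_mono_iff[of "3 / 2" "2 powr (3 / 4) :: real" 4]
    by (simp_all add: eval_nat_numeral)
  then have "(5 / 3 :: real) ^ y * (3 / 2) ^ s \<le> (2 powr (3 / 4)) ^ y * (2 powr (3 / 4)) ^ s"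
    by (intro mult_mono power_mono) auto
  also have "\<dots> = 2 powr (3 / 4 * (real y + real s))"
    by (simp add: powr_add powr_powr distrib_left flip: powr_realpow)
  also have "\<dots> \<le> 2 powr (6 * (real m + 1) / 7)"
  proof -
    have "real (7 * y + 8 * s) \<le> real (8 * (m + 1))" using assms by (simp only: of_nat_le_iff)
    then show ?thesis by (intro powr_mono) auto
  qed
  finally show ?thesis .
qed

lemma card_le_of_injective_codes:
  assumes "finite P" "\<And>x. x \<in> D \<Longrightarrow> \<exists>p\<in>P. R x p"
    and "\<And>x y p. x \<in> D \<Longrightarrow> y \<in> D \<Longrightarrow> R x p \<Longrightarrow> R y p \<Longrightarrow> x = y"
  shows "card D \<le> card P"
proof -
  obtain f where f: "\<And>x. x \<in> D \<Longrightarrow> f x \<in> P \<and> R x (f x)" using assms(2) by metis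
  then have "inj_on f D" using assms(3) by (metis inj_onI)
  with f assms(1) show ?thesis by (intro card_inj_on_le) auto
qed

lemma card_Sigma_le_mult:
  fixes c :: real
  assumes "finite A" "\<And>x. x \<in> A \<Longrightarrow> finite (B x) \<and> real (card (B x)) \<le> c"
    and "real (card A) \<le> d" "0 \<le> c"
  shows "finite (Sigma A B) \<and> real (card (Sigma A B)) \<le> d * c"
proof -
  have "real (card (Sigma A B)) = (\<Sum>x\<in>A. real (card (B x)))"
    using assms by (subst card_SigmaI) auto
  also have "\<dots> \<le> real (card A) * c" using assms by (intro sum_bounded_above) auto
  also have "\<dots> \<le> d * c" using assms by (intro mult_right_mono)
  finally show ?thesis using assms by auto
qed

text \<open>
  The factors on the right count, in this order, the moduli \<open>q\<close>, the lower residues \<open>W\<close>, the fingerprints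
  \<open>F\<close>, the remaining residues \<open>R\<close> inside the container, and the generating sets \<open>X\<close>. The tuple of these
  determines \<open>T\<close>.
\<close>

lemma card_sets_with_restricted_sums_le:
  assumes k: "2 \<le> k" "2 * N \<le> 2 ^ k" and w: "0 < w" "w < k"
  shows "real (card {T. T \<subseteq> {0..<int N} \<and> card T = k \<and> card (restricted_sums T) = m})
    \<le> real (2 * k ^ 5) * (real (2 * k ^ 5 + 1) ^ w * (real (2 * k ^ 5 + 1) ^ (8 * m div w) *
       (2 powr (6 * (real m + 1) / 7) * real (N + 1) ^ (2 * m div k + 1))))"
    (is "real (card ?D) \<le> _")
proof -
  define L where "L q W F = {R. R \<subseteq> sum_container q W F \<and> card R = k - w \<and>
    7 * card (sum_container q W F) + 8 * (k - w) \<le> 8 * (m + 1)}" for q W F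
  define small where "small A f = {F. F \<subseteq> A \<and> card F \<le> f}" for A :: "int set" and f
  define P where "P = (SIGMA q:{1..2 * k ^ 5}. SIGMA W:small {0..<int q} w.
    SIGMA F:small {0..<int q} (8 * m div w). SIGMA R:L q W F. small {0..<int N} (2 * m div k + 1))"
  define code where "code T p = (case p of (q, W, F, R, X) \<Rightarrow>
      freiman_modulus (int q) T \<and> (\<lambda>t. t mod int q) ` T = W \<union> R \<and>
      X \<subseteq> T \<and> T \<subseteq> parallelogram_closure T X)"
    for T :: "int set" and p :: "nat \<times> int set \<times> int set \<times> int set \<times> int set"
  have small: "finite (small A f) \<and> real (card (small A f)) \<le> real (n + 1) ^ f"
    if "finite A" "card A \<le> n" for A f n
  proof -
    have "(card A + 1) ^ f \<le> (n + 1) ^ f" using that by (intro power_mono) auto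
    then have "card (small A f) \<le> (n + 1) ^ f"
      using card_small_subsets_le[OF that(1), of f] by (simp add: small_def)
    then have "real (card (small A f)) \<le> real ((n + 1) ^ f)" by (simp only: of_nat_le_iff)
    then show ?thesis
      using card_small_subsets_le[OF that(1), of f] by (simp add: small_def)
  qed
  have L: "finite (L q W F) \<and> real (card (L q W F)) \<le> 2 powr (6 * (real m + 1) / 7)" for q W F
  proof (cases "7 * card (sum_container q W F) + 8 * (k - w) \<le> 8 * (m + 1)")
    case True
    have fin: "finite (sum_container q W F)"
      unfolding sum_container_def by (rule finite_Collect_conjI) simp
    from True have L_eq: "L q W F = {R. R \<subseteq> sum_container q W F \<and> card R = k - w}"
      by (simp add: L_def)
    have "real (card (L q W F)) = real (card (sum_container q W F) choose (k - w))"
      unfolding L_eq using fin by (simp add: n_subsets)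
    also have "\<dots> \<le> (1 + 2 / 3) ^ card (sum_container q W F) * (1 / (2 / 3)) ^ (k - w)"
      by (rule binomial_le_powers) simp
    also have "\<dots> \<le> 2 powr (6 * (real m + 1) / 7)"
      using five_thirds_powers_le[OF True] by simp
    finally show ?thesis unfolding L_eq using fin by simp
  qed (simp add: L_def)
  have P: "finite P \<and> real (card P)
    \<le> real (2 * k ^ 5) * (real (2 * k ^ 5 + 1) ^ w * (real (2 * k ^ 5 + 1) ^ (8 * m div w) *
       (2 powr (6 * (real m + 1) / 7) * real (N + 1) ^ (2 * m div k + 1))))"
    unfolding P_def
  proof (intro card_Sigma_le_mult)
    fix q W F R assume q: "q \<in> {1..2 * k ^ 5}"
    have "finite {0..<int q}" "card {0..<int q} \<le> 2 * k ^ 5" using q by auto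
    note * = small[OF this]
    show "finite (small {0..<int q} w)" "real (card (small {0..<int q} w)) \<le> real (2 * k ^ 5 + 1) ^ w"
      "finite (small {0..<int q} (8 * m div w))"
      "real (card (small {0..<int q} (8 * m div w))) \<le> real (2 * k ^ 5 + 1) ^ (8 * m div w)"
      using *[of w] *[of "8 * m div w"] by auto
    show "finite (L q W F)" "real (card (L q W F)) \<le> 2 powr (6 * (real m + 1) / 7)"
      using L by auto
    show "finite (small {0..<int N} (2 * m div k + 1)) \<and>
      real (card (small {0..<int N} (2 * m div k + 1))) \<le> real (N + 1) ^ (2 * m div k + 1)"
      by (rule small) auto
  qed auto
  have "card ?D \<le> card P"
  proof (rule card_le_of_injective_codes[where R = code])
    fix T assume "T \<in> ?D"
    then have T: "T \<subseteq> {0..<int N}" "card T = k" "card (restricted_sums T) = m" by auto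
    have finT: "finite T" "T \<noteq> {}" using T k finite_subset by auto
    obtain q where q: "q \<in> {1..2 * k ^ 5}" "freiman_modulus (int q) T"
      using small_freiman_modulus[OF T(1,2) k] by blast
    obtain W F R where WFR: "W \<subseteq> {0..<int q}" "card W = w" "F \<subseteq> {0..<int q}" "w * card F \<le> 8 * m"
      "R \<subseteq> sum_container q W F" "card R = k - w"
      "7 * card (sum_container q W F) + 8 * card R \<le> 8 * (m + 1)"
      "(\<lambda>t. t mod int q) ` T = W \<union> R"
      using residues_fingerprint[OF finT(1) q(2), of w] q(1) w T by auto
    obtain X where X: "X \<subseteq> T" "X \<noteq> {}" "T \<subseteq> parallelogram_closure T X"
      "(card X - 1) * (2 * k - card X) \<le> 2 * m"
      using small_generating_set[OF finT] T by auto
    have "card X \<le> k" using X(1) finT T card_mono by blast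
    \<comment> \<open>From the quadratic bound in Freiman's lemma to the linear one.\<close>
    then have "(card X - 1) * k \<le> (card X - 1) * (2 * k - card X)" by (intro mult_left_mono) auto
    with X(4) have "(card X - 1) * k \<le> 2 * m" by linarith
    then have "card X - 1 \<le> 2 * m div k" using k by (simp add: less_eq_div_iff_mult_less_eq)
    then have cX: "card X \<le> 2 * m div k + 1" by simp
    have cF: "card F \<le> 8 * m div w"
      using WFR(4) w by (simp add: less_eq_div_iff_mult_less_eq mult.commute)
    have "(q, W, F, R, X) \<in> P"
      using q WFR X cX cF T by (auto simp: P_def small_def L_def)
    moreover have "code T (q, W, F, R, X)"
      using q WFR X by (auto simp: code_def)
    ultimately show "\<exists>p\<in>P. code T p" by blast
  next
    fix S T p assume *: "S \<in> ?D" "T \<in> ?D" "code S p" "code T p"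
    obtain q W F R X where p: "p = (q, W, F, R, X)" by (cases p)
    have "finite T" using * k finite_subset by auto
    then show "S = T"
      using * by (intro determined_by_residues_and_generators[of "int q" S T X])
        (auto simp: code_def p)
  qed (use P in auto)
  then have "real (card ?D) \<le> real (card P)" by simp
  with P show ?thesis by (auto elim: order_trans)
qed

text \<open>
  The binary logarithm of the bound in \<open>card_sets_with_restricted_sums_le\<close>, for \<open>w\<close> about \<open>\<surd>k\<close> and
  \<open>log 2 N \<le> k / 80\<close>, is a constant plus a slope times \<open>m\<close>. Since \<open>m \<ge> k - 1\<close>, dividing the constant
  by \<open>k - 1\<close> turns it into a slope. The total slope tends to \<open>6/7 + 1/40 + 1/80\<close>.
\<close>

lemma exponent_eventually_small:
  "eventually (\<lambda>k::nat.
     (log 2 (2 * real k ^ 5 + 1) * (1 + sqrt (real k)) + 6 / 7 + (real k / 80 + 1)) / (real k - 1)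
     + (16 * log 2 (2 * real k ^ 5 + 1) / sqrt (real k) + 6 / 7 + 1 / 40 + 2 / real k) \<le> 19 / 20) at_top"
  by real_asymp

lemma tail_eventually_small:
  "eventually (\<lambda>k::nat. (real k ^ 2 + 1) * 2 powr (- (real k - 1) / 20) < 1 / 2) at_top"
  by real_asymp

text \<open>
  The balance of \<open>w\<close> against the fingerprint size \<open>8 * m / w\<close> is not delicate; \<open>w = \<surd>k\<close> makes both
  negligible compared with \<open>m / log k\<close>.
\<close>

lemma few_sets_with_restricted_sums:
  "eventually (\<lambda>k::nat. \<forall>N m. 1 \<le> N \<and> real N \<le> 2 powr (real k / 80) \<and> k \<le> m + 1 \<longrightarrow>
     real (card {T. T \<subseteq> {0..<int N} \<and> card T = k \<and> card (restricted_sums T) = m})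
       \<le> 2 powr (19 / 20 * real m)) at_top"
  using exponent_eventually_small eventually_ge_at_top[of 4]
proof eventually_elim
  case (elim k)
  define l where "l = log 2 (2 * real k ^ 5 + 1)"
  define w where "w = nat \<lfloor>sqrt (real k)\<rfloor>"
  have sq: "2 \<le> sqrt (real k)" "sqrt (real k) * sqrt (real k) = real k"
    using elim real_sqrt_le_mono[of 4 "real k"] by auto
  have w_le: "real w \<le> sqrt (real k)" and w_ge: "sqrt (real k) \<le> 2 * real w"
    using sq(1) unfolding w_def by linarith+
  have "sqrt (real k) * 2 \<le> sqrt (real k) * sqrt (real k)"
    using sq by (intro mult_left_mono) auto
  then have w: "0 < w" "w < k" using w_le w_ge sq by linarith+
  have l: "0 \<le> l" "2 powr l = real (2 * k ^ 5 + 1)"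
    unfolding l_def by (auto simp: add_nonneg_pos)
  show ?case
  proof (intro allI impI, elim conjE)
    fix N m :: nat
    assume N: "1 \<le> N" "real N \<le> 2 powr (real k / 80)" and m: "k \<le> m + 1"
    have "2 * real N \<le> 2 powr (real k / 80 + 1)" using N by (simp add: powr_add)
    also have "\<dots> \<le> 2 powr real k" using elim by (intro powr_mono) auto
    finally have "real (2 * N) \<le> real (2 ^ k)" by (simp add: powr_realpow)
    then have N': "2 * N \<le> 2 ^ k" by (simp only: of_nat_le_iff)
    have pow: "(2 powr x) ^ n = 2 powr (x * real n)" for x :: real and n
      by (simp add: powr_powr flip: powr_realpow)
    have N1: "real (N + 1) \<le> 2 powr (real k / 80 + 1)"
      using N by (simp add: powr_add)
    have d1: "real (8 * m div w) \<le> 16 * real m / sqrt (real k)"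
    proof -
      have "real (8 * m div w) \<le> real (8 * m) / real w" by (rule of_nat_div_le_of_nat)
      also have "\<dots> \<le> real (8 * m) / (sqrt (real k) / 2)"
        using w_ge sq w(1) by (intro divide_left_mono mult_pos_pos) (auto intro: Nat.gr0I)
      finally show ?thesis by simp
    qed
    have d2: "real (2 * m div k) \<le> 2 * real m / real k"
      using of_nat_div_le_of_nat[of "2 * m" k] by simp
    have "real (card {T. T \<subseteq> {0..<int N} \<and> card T = k \<and> card (restricted_sums T) = m})
      \<le> real (2 * k ^ 5) * (real (2 * k ^ 5 + 1) ^ w * (real (2 * k ^ 5 + 1) ^ (8 * m div w) *
         (2 powr (6 * (real m + 1) / 7) * real (N + 1) ^ (2 * m div k + 1))))"
      using elim N' w by (intro card_sets_with_restricted_sums_le) auto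
    also have "\<dots> \<le> 2 powr l * ((2 powr l) ^ w * ((2 powr l) ^ (8 * m div w) *
         (2 powr (6 * (real m + 1) / 7) * (2 powr (real k / 80 + 1)) ^ (2 * m div k + 1))))"
      using N1 unfolding l(2) by (intro mult_mono power_mono) auto
    also have "\<dots> = 2 powr (l + (l * real w + (l * real (8 * m div w) +
         (6 * (real m + 1) / 7 + (real k / 80 + 1) * real (2 * m div k + 1)))))"
      unfolding pow by (simp only: powr_add)
    also have "\<dots> \<le> 2 powr (19 / 20 * real m)"
    proof (rule powr_mono)
      define C S where "C = l * (1 + sqrt (real k)) + 6 / 7 + (real k / 80 + 1)"
        and "S = 16 * l / sqrt (real k) + 6 / 7 + 1 / 40 + 2 / real k"
      have CS: "C / (real k - 1) + S \<le> 19 / 20"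
        using elim(1) by (simp add: C_def S_def l_def)
      have "C \<ge> 0" using l sq unfolding C_def by auto
      have "l + (l * real w + (l * real (8 * m div w) +
          (6 * (real m + 1) / 7 + (real k / 80 + 1) * real (2 * m div k + 1))))
        \<le> l + (l * sqrt (real k) + (l * (16 * real m / sqrt (real k)) +
          (6 * (real m + 1) / 7 + (real k / 80 + 1) * (2 * real m / real k + 1))))"
        using l w_le d1 d2 by (intro add_mono mult_left_mono order_refl) auto
      also have "\<dots> = C + S * real m"
        using elim sq by (simp add: C_def S_def field_simps)
      also have "C \<le> C / (real k - 1) * real m"
      proof -
        have "C * (real k - 1) \<le> C * real m" using m \<open>C \<ge> 0\<close> by (intro mult_left_mono) auto
        then show ?thesis using elim by (simp add: pos_le_divide_eq)
      qed
      also have "C / (real k - 1) * real m + S * real m = (C / (real k - 1) + S) * real m"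
        by (simp add: distrib_right)
      also have "\<dots> \<le> 19 / 20 * real m" using CS by (intro mult_right_mono) auto
      finally show "l + (l * real w + (l * real (8 * m div w) +
          (6 * (real m + 1) / 7 + (real k / 80 + 1) * real (2 * m div k + 1))))
        \<le> 19 / 20 * real m" by simp
    qed simp
    finally show "real (card {T. T \<subseteq> {0..<int N} \<and> card T = k \<and> card (restricted_sums T) = m})
       \<le> 2 powr (19 / 20 * real m)" .
  qed
qed

lemma union_bound_eventually_small:
  "eventually (\<lambda>k::nat. \<forall>N. 1 \<le> N \<and> real N \<le> 2 powr (real k / 80) \<longrightarrow>
     (\<Sum>T | T \<subseteq> {0..<int N} \<and> card T = k. (1 / 2) ^ card (restricted_sums T)) < (1 / 2 :: real)) at_top"
  using few_sets_with_restricted_sums tail_eventually_small eventually_ge_at_top[of 1]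
proof eventually_elim
  case (elim k)
  show ?case
  proof (intro allI impI, elim conjE)
    fix N :: nat assume N: "1 \<le> N" "real N \<le> 2 powr (real k / 80)"
    define \<F> where "\<F> = {T. T \<subseteq> {0..<int N} \<and> card T = k}"
    have fin: "finite \<F>" by (simp add: \<F>_def)
    have range: "card (restricted_sums T) \<in> {k - 1..k\<^sup>2}" if "T \<in> \<F>" for T
    proof -
      have "finite T" "card T = k" using that finite_subset by (auto simp: \<F>_def)
      then show ?thesis
        using card_restricted_sums_le[of T] card_le_Suc_card_restricted_sums[of T] by auto
    qed
    have "(\<Sum>T\<in>\<F>. (1 / 2 :: real) ^ card (restricted_sums T))
        = (\<Sum>m=k - 1..k\<^sup>2. \<Sum>T\<in>{T\<in>\<F>. card (restricted_sums T) = m}. (1 / 2) ^ card (restricted_sums T))"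
      using fin range by (intro sum.group[symmetric]) auto
    also have "\<dots> \<le> (\<Sum>m=k - 1..k\<^sup>2. 2 powr (- (real k - 1) / 20))"
    proof (rule sum_mono)
      fix m assume m: "m \<in> {k - 1..k\<^sup>2}"
      have "(\<Sum>T\<in>{T\<in>\<F>. card (restricted_sums T) = m}. (1 / 2 :: real) ^ card (restricted_sums T))
          = real (card {T. T \<subseteq> {0..<int N} \<and> card T = k \<and> card (restricted_sums T) = m}) * (1 / 2) ^ m"
        by (simp add: \<F>_def conj_assoc)
      also have "\<dots> \<le> 2 powr (19 / 20 * real m) * (1 / 2) ^ m"
        using elim(1) N m by (intro mult_right_mono) auto
      also have "(1 / 2 :: real) ^ m = 2 powr (- real m)"
        by (simp add: powr_minus powr_realpow power_one_over inverse_eq_divide)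
      also have "2 powr (19 / 20 * real m) * 2 powr (- real m) = 2 powr (- real m / 20)"
        by (simp flip: powr_add)
      also have "\<dots> \<le> 2 powr (- (real k - 1) / 20)"
        using m elim by (intro powr_mono) (auto simp: of_nat_diff)
      finally show "(\<Sum>T\<in>{T\<in>\<F>. card (restricted_sums T) = m}. (1 / 2 :: real) ^ card (restricted_sums T))
          \<le> 2 powr (- (real k - 1) / 20)" .
    qed
    also have "\<dots> \<le> (real k ^ 2 + 1) * 2 powr (- (real k - 1) / 20)"
    proof -
      have "real (card {k - 1..k\<^sup>2}) \<le> real (k\<^sup>2 + 1)" by (intro of_nat_mono) auto
      then show ?thesis by (simp only: sum_constant) (intro mult_right_mono; simp)
    qed
    also have "\<dots> < 1 / 2" by (rule elim(2))
    finally show "(\<Sum>T | T \<subseteq> {0..<int N} \<and> card T = k. (1 / 2) ^ card (restricted_sums T)) < (1 / 2 :: real)"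
      by (simp add: \<F>_def)
  qed
qed

section \<open>The random set\<close>

text \<open>
  The probabilistic method, as a count of the subsets \<open>A\<close> of \<open>U\<close>: \<open>2 ^ (card U - card (\<sigma> T))\<close> of them
  contain \<open>\<sigma> T\<close>, and as many are disjoint from it.
\<close>

lemma splitting_set_exists:
  assumes "finite U" "finite \<F>" and sub: "\<And>T. T \<in> \<F> \<Longrightarrow> \<sigma> T \<subseteq> U"
    and small: "(\<Sum>T\<in>\<F>. (1 / 2) ^ card (\<sigma> T)) < (1 / 2 :: real)"
  shows "\<exists>A\<subseteq>U. \<forall>T\<in>\<F>. \<not> \<sigma> T \<subseteq> A \<and> \<sigma> T \<inter> A \<noteq> {}"
proof (rule ccontr)
  assume neg: "\<not> ?thesis"
  define bad where "bad T = {A. A \<subseteq> U \<and> \<sigma> T \<subseteq> A} \<union> {A. A \<subseteq> U \<and> \<sigma> T \<inter> A = {}}" for T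
  have card_bad: "real (card (bad T)) \<le> 2 * (2 ^ card U * (1 / 2) ^ card (\<sigma> T))" if T: "T \<in> \<F>" for T
  proof -
    have fin: "finite (U - \<sigma> T)" "card (U - \<sigma> T) = card U - card (\<sigma> T)" "card (\<sigma> T) \<le> card U"
      using sub[OF T] assms(1) finite_subset[OF sub[OF T] assms(1)]
      by (simp_all add: card_Diff_subset card_mono)
    have "{A. A \<subseteq> U \<and> \<sigma> T \<subseteq> A} \<subseteq> (\<lambda>B. B \<union> \<sigma> T) ` Pow (U - \<sigma> T)"
    proof clarify
      fix A assume "A \<subseteq> U" "\<sigma> T \<subseteq> A"
      then show "A \<in> (\<lambda>B. B \<union> \<sigma> T) ` Pow (U - \<sigma> T)"
        by (intro image_eqI[of _ _ "A - \<sigma> T"]) auto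
    qed
    then have "card {A. A \<subseteq> U \<and> \<sigma> T \<subseteq> A} \<le> card (Pow (U - \<sigma> T))"
      using fin by (intro surj_card_le) auto
    moreover have "bad T = {A. A \<subseteq> U \<and> \<sigma> T \<subseteq> A} \<union> Pow (U - \<sigma> T)"
      unfolding bad_def by blast
    then have "card (bad T) \<le> card {A. A \<subseteq> U \<and> \<sigma> T \<subseteq> A} + card (Pow (U - \<sigma> T))"
      by (simp only: card_Un_le)
    moreover have "card (Pow (U - \<sigma> T)) = 2 ^ (card U - card (\<sigma> T))"
      using fin by (simp only: card_Pow)
    ultimately have "card (bad T) \<le> 2 * 2 ^ (card U - card (\<sigma> T))" by linarith
    then have "real (card (bad T)) \<le> real (2 * 2 ^ (card U - card (\<sigma> T)))"
      by (simp only: of_nat_le_iff)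
    also have "\<dots> = 2 * (2 ^ card U * (1 / 2) ^ card (\<sigma> T))"
    proof -
      have "(2::real) ^ card U = 2 ^ (card U - card (\<sigma> T)) * 2 ^ card (\<sigma> T)"
        using fin(3) by (simp flip: power_add)
      then show ?thesis by (simp add: power_one_over)
    qed
    finally show ?thesis .
  qed
  have "Pow U \<subseteq> (\<Union>T\<in>\<F>. bad T)" using neg unfolding bad_def by blast
  moreover have "finite (\<Union>T\<in>\<F>. bad T)"
    using assms(1,2) by (auto simp: bad_def)
  ultimately have "card (Pow U) \<le> card (\<Union>T\<in>\<F>. bad T)" by (intro card_mono)
  also have "\<dots> \<le> (\<Sum>T\<in>\<F>. card (bad T))" using assms(2) by (rule card_UN_le)
  finally have "real (2 ^ card U) \<le> real (\<Sum>T\<in>\<F>. card (bad T))"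
    using assms(1) by (simp only: card_Pow of_nat_le_iff)
  also have "\<dots> = (\<Sum>T\<in>\<F>. real (card (bad T)))" by simp
  also have "\<dots> \<le> (\<Sum>T\<in>\<F>. 2 * (2 ^ card U * (1 / 2) ^ card (\<sigma> T)))"
    by (intro sum_mono card_bad)
  also have "\<dots> = 2 * 2 ^ card U * (\<Sum>T\<in>\<F>. (1 / 2) ^ card (\<sigma> T))"
    by (simp add: sum_distrib_left mult.assoc)
  also have "\<dots> < 2 * 2 ^ card U * (1 / 2)"
    using small by (intro mult_strict_left_mono) auto
  finally show False by simp
qed

text \<open>
  The sums of two elements of the lower half lie in \<open>[0, N)\<close>, those of the upper half in \<open>[N, 2 * N)\<close>.
\<close>

lemma card_residues_of_sums_in_half:
  fixes T :: "int set"
  assumes "T \<subseteq> {0..<(N + 1) div 2} \<or> T \<subseteq> {(N + 1) div 2..<N}"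
  shows "card ((\<lambda>t. t mod N) ` restricted_sums T) = card (restricted_sums T)"
proof (rule card_image, rule inj_onI)
  fix x y assume xy: "x \<in> restricted_sums T" "y \<in> restricted_sums T" "x mod N = y mod N"
  have "\<bar>x - y\<bar> < N"
    using assms
  proof
    assume T: "T \<subseteq> {0..<(N + 1) div 2}"
    have "0 \<le> z \<and> z < N" if "z \<in> restricted_sums T" for z
    proof -
      from that obtain a b where ab: "z = a + b" "a \<in> T" "b \<in> T" "a \<noteq> b"
        by (auto simp: restricted_sums_def)
      with T have "a \<in> {0..<(N + 1) div 2}" "b \<in> {0..<(N + 1) div 2}" by blast+
      with ab show ?thesis by auto
    qed
    from this[OF xy(1)] this[OF xy(2)] show ?thesis by linarith
  next
    assume T: "T \<subseteq> {(N + 1) div 2..<N}"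
    have "N \<le> z \<and> z < 2 * N" if "z \<in> restricted_sums T" for z
    proof -
      from that obtain a b where ab: "z = a + b" "a \<in> T" "b \<in> T" "a \<noteq> b"
        by (auto simp: restricted_sums_def)
      with T have "a \<in> {(N + 1) div 2..<N}" "b \<in> {(N + 1) div 2..<N}" by blast+
      with ab show ?thesis by auto
    qed
    from this[OF xy(1)] this[OF xy(2)] show ?thesis by linarith
  qed
  moreover have "N dvd x - y" using xy(3) by (simp add: mod_eq_dvd_iff)
  ultimately show "x = y" using zdvd_imp_le[of N "\<bar>x - y\<bar>"] by fastforce
qed

lemma large_subset_of_half:
  fixes S :: "int set"
  assumes S: "S \<subseteq> {0..<N}" and large: "real (card S) \<ge> 2 * x" and k: "k = nat \<lceil>x\<rceil>"
  shows "\<exists>T\<subseteq>S. card T = k \<and> (T \<subseteq> {0..<(N + 1) div 2} \<or> T \<subseteq> {(N + 1) div 2..<N})"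
proof -
  define S1 S2 where "S1 = S \<inter> {0..<(N + 1) div 2}" and "S2 = S \<inter> {(N + 1) div 2..<N}"
  have "S = S1 \<union> S2" using S by (auto simp: S1_def S2_def)
  then have "card S \<le> card S1 + card S2" by (metis card_Un_le)
  then have "real (card S) \<le> real (card S1) + real (card S2)" by linarith
  with large have "x \<le> real (card S1) \<or> x \<le> real (card S2)" by linarith
  then have "k \<le> card S1 \<or> k \<le> card S2" using k by linarith
  then obtain T where "card T = k" "T \<subseteq> S1 \<or> T \<subseteq> S2"
    by (metis obtain_subset_with_card_n)
  then show ?thesis by (auto simp: S1_def S2_def)
qed

theorem theorem8:
  shows "\<exists>N\<^sub>0. \<forall>N::nat. N \<ge> N\<^sub>0 \<longrightarrow>
    (\<exists>A \<subseteq> carrier (integer_mod_group N).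
      \<not> (\<exists>S \<subseteq> carrier (integer_mod_group N).
            clique S (cayley_sum_edges (integer_mod_group N) A) \<and>
            real (card S) \<ge> 160 * log 2 (real N)) \<and>
      \<not> (\<exists>S \<subseteq> carrier (integer_mod_group N).
            indep S (cayley_sum_edges (integer_mod_group N) A) \<and>
            real (card S) \<ge> 160 * log 2 (real N)))"
proof -
  have "filterlim (\<lambda>N::nat. nat \<lceil>80 * log 2 (real N)\<rceil>) at_top at_top"
    by real_asymp
  then have "eventually (\<lambda>N::nat. \<forall>M. 1 \<le> M \<and> real M \<le> 2 powr (real (nat \<lceil>80 * log 2 (real N)\<rceil>) / 80) \<longrightarrow>
     (\<Sum>T | T \<subseteq> {0..<int M} \<and> card T = nat \<lceil>80 * log 2 (real N)\<rceil>. (1 / 2) ^ card (restricted_sums T))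
       < (1 / 2 :: real)) at_top"
    using union_bound_eventually_small unfolding filterlim_iff by blast
  then have "eventually (\<lambda>N::nat. \<exists>A \<subseteq> carrier (integer_mod_group N).
      \<not> (\<exists>S \<subseteq> carrier (integer_mod_group N).
            clique S (cayley_sum_edges (integer_mod_group N) A) \<and>
            real (card S) \<ge> 160 * log 2 (real N)) \<and>
      \<not> (\<exists>S \<subseteq> carrier (integer_mod_group N).
            indep S (cayley_sum_edges (integer_mod_group N) A) \<and>
            real (card S) \<ge> 160 * log 2 (real N))) at_top"
    using eventually_ge_at_top[of 1]
  proof eventually_elim
    case (elim N)
    define k where "k = nat \<lceil>80 * log 2 (real N)\<rceil>"
    define G where "G = integer_mod_group N"
    interpret comm_group G unfolding G_def by simp
    have carrier: "carrier G = {0..<int N}" and mult: "i \<otimes>\<^bsub>G\<^esub> j = (i + j) mod int N" for i j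
      using elim by (auto simp: G_def carrier_integer_mod_group)
    \<comment> \<open>Only sets inside one half matter, since reduction mod \<open>N\<close> loses none of their sums.\<close>
    define \<F> where "\<F> = {T. card T = k \<and>
      (T \<subseteq> {0..<(int N + 1) div 2} \<or> T \<subseteq> {(int N + 1) div 2..<int N})}"
    define \<sigma> where "\<sigma> T = (\<lambda>t. t mod int N) ` restricted_sums T" for T
    have \<F>_sub: "\<F> \<subseteq> {T. T \<subseteq> {0..<int N} \<and> card T = k}"
      by (auto simp: \<F>_def subset_iff)
    have "real N = 2 powr (log 2 (real N))" using elim by simp
    also have "\<dots> \<le> 2 powr (real k / 80)"
      unfolding k_def by (intro powr_mono) (simp_all, linarith)
    finally have "(\<Sum>T | T \<subseteq> {0..<int N} \<and> card T = k. (1 / 2) ^ card (restricted_sums T)) < (1 / 2 :: real)"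
      using elim unfolding k_def by blast
    moreover have "(\<Sum>T\<in>\<F>. (1 / 2 :: real) ^ card (\<sigma> T)) = (\<Sum>T\<in>\<F>. (1 / 2) ^ card (restricted_sums T))"
      unfolding \<sigma>_def by (intro sum.cong refl arg_cong2[where f = power] card_residues_of_sums_in_half)
        (auto simp: \<F>_def)
    moreover have "(\<Sum>T\<in>\<F>. (1 / 2 :: real) ^ card (restricted_sums T))
        \<le> (\<Sum>T | T \<subseteq> {0..<int N} \<and> card T = k. (1 / 2) ^ card (restricted_sums T))"
      using \<F>_sub by (intro sum_mono2) auto
    ultimately have small: "(\<Sum>T\<in>\<F>. (1 / 2 :: real) ^ card (\<sigma> T)) < 1 / 2" by linarith
    have "finite \<F>" using \<F>_sub by (rule finite_subset) simp
    moreover have "\<sigma> T \<subseteq> {0..<int N}" for T using elim by (auto simp: \<sigma>_def)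
    ultimately obtain A where A: "A \<subseteq> {0..<int N}" "\<And>T. T \<in> \<F> \<Longrightarrow> \<not> \<sigma> T \<subseteq> A \<and> \<sigma> T \<inter> A \<noteq> {}"
      using splitting_set_exists[of "{0..<int N}" \<F> \<sigma>] small by auto
    have edge: "{i, j} \<in> cayley_sum_edges G A \<longleftrightarrow> i \<noteq> j \<and> (i + j) mod int N \<in> A"
      if "i \<in> carrier G" "j \<in> carrier G" for i j
      using doubleton_in_cayley_sum_edges[OF that, of A] by (simp add: mult)
    have "\<not> clique S (cayley_sum_edges G A) \<and> \<not> indep S (cayley_sum_edges G A)"
      if S: "S \<subseteq> carrier G" "real (card S) \<ge> 160 * log 2 (real N)" for S
    proof -
      obtain T where T: "T \<subseteq> S" "T \<in> \<F>"
        using large_subset_of_half[of S "int N" "80 * log 2 (real N)" k] S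
        by (auto simp: carrier k_def \<F>_def)
      have "\<sigma> T \<subseteq> A" if "clique S (cayley_sum_edges G A)"
      proof
        fix s assume "s \<in> \<sigma> T"
        then obtain a b where ab: "a \<in> T" "b \<in> T" "a \<noteq> b" "s = (a + b) mod int N"
          by (auto simp: \<sigma>_def restricted_sums_def)
        then have "{a, b} \<in> cayley_sum_edges G A"
          using that T unfolding clique_def by blast
        then show "s \<in> A" using edge[of a b] ab T S by blast
      qed
      moreover have "\<sigma> T \<inter> A = {}" if "indep S (cayley_sum_edges G A)"
      proof -
        have "s \<notin> A" if "s \<in> \<sigma> T" for s
        proof -
          from that obtain a b where ab: "a \<in> T" "b \<in> T" "a \<noteq> b" "s = (a + b) mod int N"
            by (auto simp: \<sigma>_def restricted_sums_def)
          then have "{a, b} \<notin> cayley_sum_edges G A"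
            using \<open>indep S (cayley_sum_edges G A)\<close> T unfolding indep_def by blast
          then show "s \<notin> A" using edge[of a b] ab T S by blast
        qed
        then show ?thesis by blast
      qed
      ultimately show ?thesis using A(2)[OF T(2)] by blast
    qed
    then show ?case
      using A(1) unfolding G_def[symmetric] carrier[symmetric] by blast
  qed
  then show ?thesis by (simp add: eventually_at_top_linorder)
qed

end
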